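(* For every non-negative integer $n$, the following three sets have the same cardinality. 1. The set of ordinary partitions of $n$ in which each part appears at most three times. 2. The set of bicolored partitions of $n$ (each part colored red or blue) such that (a) neither blue parts nor red parts repeat (each colored part appears at most once), and (b) going through the parts from smallest to largest, for each red part $b$ there is a blue part $b$ or a blue part $b+1$, and these blue parts are different for different red parts (i.e., distinct red parts are associated to distinct blue parts). 3. The set of bicolored partitions of $n$ such that (a) both blue and red parts appear at most once; (b) a red $1$ does not appear as a part; (c) for any blue part $b$, there is no red part $b+1$ and no red part $b+2$; (d) in any sublist of successive parts ending with a blue part $b$, one cannot have differences of the form $[1,2,2,\dots,2]$ (a $1$ followed by any number, possibly zero, of $2$'s) between successive parts, where all parts before the final blue $b$ are red. That is, one cannot have a red $b-1$ together with a blue $b$; nor a red $b-3$, a red $b-2$ and a blue $b$; nor a red $b-5$, a red $b-4$, a red $b-2$ and a blue $b$; and in general, for no $k\ge 1$ can one have red parts $b-2k+1$ and $b-2j$ for $j=1,\dots,k-1$ together with a blue part $b$.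
   Context: A partition of $n$ is an unordered sum of positive integers adding up to $n$ (the empty partition is the unique partition of $0$). A bicolored partition is a partition each of whose parts is assigned one of two colors, red or blue; a red part and a blue part of the same size are considered different parts.
   Formalization: In 3(d) the listed red parts with a blue b are forbidden only if no blue part has size from b−2k+1 to b−1 (a red b does not matter); forbidding mere co-occurrence, as the "That is" sentence says, fails at n=7 (counts 12, 12, 11, losing red 2, blue 2, blue 3). *)

theory Defs
  imports "HOL-Library.Multiset" "HOL-Library.Equipollence"
begin

definition partitions :: "nat \<Rightarrow> nat multiset set" where
  "partitions n = {P. (\<forall>b \<in># P. b > 0) \<and> sum_mset P = n}"

datatype color = Red | Blue

definition bicolored_partitions :: "nat \<Rightarrow> (nat \<times> color) multiset set" where
  "bicolored_partitions n = {P. (\<forall>p \<in># P. fst p > 0) \<and> sum_mset (image_mset fst P) = n}"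

definition red_parts :: "(nat \<times> color) multiset \<Rightarrow> nat set" where
  "red_parts P = {b. (b, Red) \<in># P}"

definition blue_parts :: "(nat \<times> color) multiset \<Rightarrow> nat set" where
  "blue_parts P = {b. (b, Blue) \<in># P}"

definition no_repeats :: "(nat \<times> color) multiset \<Rightarrow> bool" where
  "no_repeats P \<longleftrightarrow> (\<forall>p. count P p \<le> 1)"

definition partitions_at_most_thrice :: "nat \<Rightarrow> nat multiset set" where
  "partitions_at_most_thrice n = {P \<in> partitions n. \<forall>b. count P b \<le> 3}"

definition red_matched :: "(nat \<times> color) multiset \<Rightarrow> bool" where
  "red_matched P \<longleftrightarrow>
     (\<exists>f. inj_on f (red_parts P) \<and>
        (\<forall>b \<in> red_parts P. f b \<in> blue_parts P \<and> (f b = b \<or> f b = b + 1)))"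

definition matched_bicolored_partitions :: "nat \<Rightarrow> (nat \<times> color) multiset set" where
  "matched_bicolored_partitions n =
     {P \<in> bicolored_partitions n. no_repeats P \<and> red_matched P}"

(* The parts b - 2k + 1, b - 2k + 2, b - 2k + 4, ..., b - 2, b have successive differences
   1, 2, ..., 2. The last conjunct says that the parts preceding the final blue b in the
   sublist are all red: there is no blue part whose size lies in the range from b - 2k + 1
   to b - 1. Without it, red 2, blue 2, blue 3 would be excluded, although red 2 and blue 3
   are not successive there; a red part b does not precede the blue part b. The guard
   2 * k <= b makes b - 2k + 1 positive and keeps the subtractions from truncating. *)
definition forbidden_run :: "(nat \<times> color) multiset \<Rightarrow> nat \<Rightarrow> nat \<Rightarrow> bool" where
  "forbidden_run P b k \<longleftrightarrow>
     1 \<le> k \<and> 2 * k \<le> b \<and>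
     b \<in> blue_parts P \<and>
     b - 2 * k + 1 \<in> red_parts P \<and>
     (\<forall>j \<in> {1..k - 1}. b - 2 * j \<in> red_parts P) \<and>
     (\<forall>c \<in> {b - 2 * k + 1..<b}. c \<notin> blue_parts P)"

definition run_free_bicolored_partitions :: "nat \<Rightarrow> (nat \<times> color) multiset set" where
  "run_free_bicolored_partitions n =
     {P \<in> bicolored_partitions n.
        no_repeats P \<and>
        1 \<notin> red_parts P \<and>
        (\<forall>b \<in> blue_parts P. b + 1 \<notin> red_parts P \<and> b + 2 \<notin> red_parts P) \<and>
        (\<nexists>b k. forbidden_run P b k)}"

end

theory Submission
  imports Defs "HOL-Computational_Algebra.Formal_Power_Series"
begin

text \<open>
  All three families have the generating function
  \[ \sum_n q^{n(n+1)/2} \frac{(-q;q)_n}{(q;q)_n} = \prod_k (1 + q^k)(1 + q^{2k}), \]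
  the equality being Lebesgue's identity. With
  \[ F(w,y) = \sum_n w^n q^{n(n-1)/2} \frac{(-y;q)_n}{(q;q)_n}, \]
  the recurrence $F(w,y) = (1+w) F(wq,y) + wy F(wq^2,y)$ determines $F$ as a power series with
  $F(0,y) = 1$, and it implies $F(w,y) = F(w,yq) + wy F(wq,yq)$ because the right-hand side obeys
  the same recurrence. Two applications give $F(q,y) = (1+yq) F(q,yq^2)$, which iterates to the
  product. The bicolored families are recognized by finite automata that read the part sizes in
  increasing order; the generating functions of the accepted continuations from size $b$ on satisfy
  a linear system that is solved by the $F(q^i,q^j)$ with $i$ close to $b$.
\<close>

subsection \<open>The two-parameter series behind Lebesgue's identity\<close>

lemma X_power_dvd_iff: "(fps_X :: int fps) ^ m dvd f \<longleftrightarrow> (\<forall>N<m. fps_nth f N = 0)"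
proof
  assume "fps_X ^ m dvd f"
  then show "\<forall>N<m. fps_nth f N = 0"
    by (auto simp: fps_X_power_mult_nth elim!: dvdE)
next
  assume *: "\<forall>N<m. fps_nth f N = 0"
  have "f = fps_X ^ m * Abs_fps (\<lambda>N. fps_nth f (N + m))"
    using * by (auto simp: fps_eq_iff fps_X_power_mult_nth)
  then show "fps_X ^ m dvd f"
    by (metis dvd_triv_left)
qed

lemma X_power_dvd_imp_eq:
  assumes "\<And>m. (fps_X :: int fps) ^ m dvd f - g"
  shows "f = g"
proof (rule fps_ext)
  fix n
  show "fps_nth f n = fps_nth g n"
    using assms[of "Suc n"] unfolding X_power_dvd_iff by simp
qed

text \<open>Uniqueness principle for the recurrences below. \<open>D\<close> collects differences of
  two solutions, each controlled by members of larger index. Since \<open>D b s\<close> vanishes to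
  order \<open>b\<close>, the claim is clear once the index reaches \<open>m\<close>, and it
  propagates downwards from there.\<close>

lemma X_power_dvd_descent:
  fixes D :: "nat \<Rightarrow> 's \<Rightarrow> int fps"
  assumes base: "\<And>b s. b > 0 \<Longrightarrow> fps_X ^ b dvd D b s"
    and step: "\<And>b s. b > 0 \<Longrightarrow> (\<And>c t. c > b \<Longrightarrow> fps_X ^ m dvd D c t) \<Longrightarrow> fps_X ^ m dvd D b s"
    and "b > 0"
  shows "fps_X ^ m dvd D b s"
  using \<open>b > 0\<close>
proof (induction "m - b" arbitrary: b s rule: less_induct)
  case less
  show ?case
  proof (cases "m \<le> b")
    case True
    then show ?thesis
      using base[OF less.prems] le_imp_power_dvd dvd_trans by blast
  next
    case False
    show ?thesis
    proof (rule step[OF less.prems])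
      fix c t assume "b < c"
      then show "fps_X ^ m dvd D c t"
        using False less.prems by (intro less.hyps) auto
    qed
  qed
qed

text \<open>\<open>lebesgue i j\<close> is $F(q^i,q^j)$.\<close>

function lebesgue_coeff :: "nat \<Rightarrow> nat \<Rightarrow> nat \<Rightarrow> int" where
  "lebesgue_coeff i j N =
     (if N < i then of_bool (N = 0)
      else lebesgue_coeff (i + 1) j N + lebesgue_coeff (i + 1) j (N - i) +
        (if N < i + j then 0 else lebesgue_coeff (i + 2) j (N - (i + j))))"
  by auto
termination
  by (relation "measure (\<lambda>(i, j, N). Suc N - i)") auto

declare lebesgue_coeff.simps [simp del]

definition lebesgue :: "nat \<Rightarrow> nat \<Rightarrow> int fps" where
  "lebesgue i j = Abs_fps (lebesgue_coeff i j)"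

lemma lebesgue_rec:
  "lebesgue i j = (1 + fps_X ^ i) * lebesgue (i + 1) j + fps_X ^ (i + j) * lebesgue (i + 2) j"
proof (rule fps_ext)
  fix N
  show "fps_nth (lebesgue i j) N = fps_nth ((1 + fps_X ^ i) * lebesgue (i + 1) j +
      fps_X ^ (i + j) * lebesgue (i + 2) j) N"
    unfolding lebesgue_def distrib_right fps_add_nth fps_X_power_mult_nth mult_1 fps_nth_Abs_fps
    \<comment> \<open>For \<open>N < i\<close> the right-hand side reduces to a coefficient of
      \<open>lebesgue (i + 1) j\<close>, which must be evaluated too; hence the second unfolding at
      \<open>Suc i\<close>.\<close>
    by (subst lebesgue_coeff.simps) (simp add: lebesgue_coeff.simps[of "Suc i" j N])
qed

lemma X_power_dvd_lebesgue: "fps_X ^ i dvd lebesgue i j - 1"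
  by (auto simp: X_power_dvd_iff lebesgue_def lebesgue_coeff.simps)

text \<open>For fixed \<open>j\<close> both sides solve the recurrence in \<open>i\<close> and are 1
  modulo \<open>fps_X ^ i\<close>, so the descent applies to their difference
  \<open>D\<close>.\<close>

lemma lebesgue_shift:
  assumes "i > 0"
  shows "lebesgue i j = lebesgue i (j + 1) + fps_X ^ (i + j) * lebesgue (i + 1) (j + 1)"
proof -
  define D :: "nat \<Rightarrow> unit \<Rightarrow> int fps" where
    "D = (\<lambda>i _. lebesgue i j - (lebesgue i (j + 1) + fps_X ^ (i + j) * lebesgue (i + 1) (j + 1)))"
  have rec: "D i u = (1 + fps_X ^ i) * D (i + 1) u + fps_X ^ (i + j) * D (i + 2) u" for i u
  proof -
    have "lebesgue (i + 1) (j + 1) = (1 + fps_X * fps_X ^ i) * lebesgue (i + 2) (j + 1) +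
        fps_X ^ 2 * fps_X ^ i * fps_X ^ j * lebesgue (i + 3) (j + 1)"
      using lebesgue_rec[of "i + 1" "j + 1"] by (simp add: numeral_eq_Suc power_add algebra_simps)
    moreover have "lebesgue i (j + 1) = (1 + fps_X ^ i) * lebesgue (i + 1) (j + 1) +
        fps_X * fps_X ^ i * fps_X ^ j * lebesgue (i + 2) (j + 1)"
      using lebesgue_rec[of i "j + 1"] by (simp add: power_add algebra_simps)
    moreover have "lebesgue i j = (1 + fps_X ^ i) * lebesgue (i + 1) j +
        fps_X ^ i * fps_X ^ j * lebesgue (i + 2) j"
      using lebesgue_rec[of i j] by (simp add: power_add)
    \<comment> \<open>Here \<open>q\<close>, \<open>x\<close>, \<open>y\<close> stand for
      \<open>fps_X\<close>, \<open>fps_X ^ i\<close>, \<open>fps_X ^ j\<close>; the \<open>f\<close>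
      and \<open>h\<close> with index k stand for \<open>lebesgue (i + k)\<close> at second argument
      \<open>j\<close> and \<open>j + 1\<close>. The recurrence for \<open>D\<close> thus becomes a
      polynomial identity.\<close>
    moreover have "f0 - (h0 + x * y * h1) =
        (1 + x) * (f1 - (h1 + x * q * y * h2)) + x * y * (f2 - (h2 + x * q ^ 2 * y * h3))"
      if "h1 = (1 + q * x) * h2 + q ^ 2 * x * y * h3" "h0 = (1 + x) * h1 + q * x * y * h2"
        "f0 = (1 + x) * f1 + x * y * f2" for f0 f1 f2 h0 h1 h2 h3 x y q :: "int fps"
      using that by algebra
    moreover have "i + 1 + 1 = i + 2" "i + 2 + 1 = i + 3"
      by auto
    ultimately show ?thesis
      unfolding D_def power_add power_one_right by metis
  qed
  have "fps_X ^ m dvd D i ()" for m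
  proof (rule X_power_dvd_descent[where D = D])
    fix i :: nat and u :: unit
    have "D i u = (lebesgue i j - 1) - (lebesgue i (j + 1) - 1) -
        fps_X ^ i * (fps_X ^ j * lebesgue (i + 1) (j + 1))"
      by (simp add: D_def power_add algebra_simps)
    then show "fps_X ^ i dvd D i u"
      by (simp only: X_power_dvd_lebesgue dvd_diff dvd_triv_left)
  next
    fix i :: nat and u :: unit
    assume "\<And>c t. c > i \<Longrightarrow> fps_X ^ m dvd D c t"
    then show "fps_X ^ m dvd D i u"
      by (subst rec) (intro dvd_add dvd_mult; simp)
  qed (use assms in simp)
  then have "fps_X ^ m dvd lebesgue i j -
      (lebesgue i (j + 1) + fps_X ^ (i + j) * lebesgue (i + 1) (j + 1))" for m
    by (simp add: D_def)
  then show ?thesis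
    by (rule X_power_dvd_imp_eq)
qed

text \<open>Shifting the second argument twice leaves \<open>lebesgue 1 (j + 2)\<close> plus
  \<open>fps_X ^ (j + 1)\<close> times a combination of \<open>lebesgue 2 (j + 2)\<close> and
  \<open>lebesgue 3 (j + 2)\<close>. Because w = q, that combination is exactly
  \<open>lebesgue_rec\<close> for \<open>lebesgue 1 (j + 2)\<close>.\<close>

lemma lebesgue_1_step: "lebesgue 1 j = (1 + fps_X ^ (j + 1)) * lebesgue 1 (j + 2)"
proof -
  have "lebesgue 1 j = lebesgue 1 (j + 1) + fps_X * fps_X ^ j * lebesgue 2 (j + 1)"
    using lebesgue_shift[of 1 j] by (simp add: numeral_eq_Suc)
  moreover have "lebesgue 1 (j + 1) = lebesgue 1 (j + 2) + fps_X ^ 2 * fps_X ^ j * lebesgue 2 (j + 2)"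
    using lebesgue_shift[of 1 "j + 1"] by (simp add: numeral_eq_Suc algebra_simps)
  moreover have "lebesgue 2 (j + 1) = lebesgue 2 (j + 2) + fps_X ^ 3 * fps_X ^ j * lebesgue 3 (j + 2)"
    using lebesgue_shift[of 2 "j + 1"] by (simp add: numeral_eq_Suc algebra_simps)
  moreover have "lebesgue 1 (j + 2) = (1 + fps_X) * lebesgue 2 (j + 2) +
      fps_X ^ 3 * fps_X ^ j * lebesgue 3 (j + 2)"
    using lebesgue_rec[of 1 "j + 2"] by (simp add: numeral_eq_Suc algebra_simps)
  moreover have "f1 = (1 + q * y) * k1"
    if "f1 = h1 + q * y * h2" "h1 = k1 + q ^ 2 * y * k2" "h2 = k2 + q ^ 3 * y * k3"
      "k1 = (1 + q) * k2 + q ^ 3 * y * k3" for f1 h1 h2 k1 k2 k3 q y :: "int fps"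
    using that by algebra
  ultimately have "lebesgue 1 j = (1 + fps_X * fps_X ^ j) * lebesgue 1 (j + 2)"
    by blast
  then show ?thesis
    by simp
qed

subsection \<open>Generating functions of pairs of sets\<close>

text \<open>In a pair, the first set holds the red parts and the second one the blue parts.\<close>

definition part_pairs :: "(nat set \<Rightarrow> nat set \<Rightarrow> bool) \<Rightarrow> nat \<Rightarrow> (nat set \<times> nat set) set" where
  "part_pairs P N =
     {(R, B). finite R \<and> finite B \<and> 0 \<notin> R \<and> 0 \<notin> B \<and> P R B \<and> \<Sum>R + \<Sum>B = N}"

definition gf :: "(nat set \<Rightarrow> nat set \<Rightarrow> bool) \<Rightarrow> int fps" where
  "gf P = Abs_fps (\<lambda>N. int (card (part_pairs P N)))"

lemma finite_part_pairs: "finite (part_pairs P N)"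
proof (rule finite_subset)
  show "part_pairs P N \<subseteq> Pow {..N} \<times> Pow {..N}"
  proof
    fix p assume "p \<in> part_pairs P N"
    then obtain R B where p: "p = (R, B)" "finite R" "finite B" "\<Sum>R + \<Sum>B = N"
      by (auto simp: part_pairs_def)
    then have "r \<le> \<Sum>R" if "r \<in> R" for r
      using member_le_sum[of r R "\<lambda>x. x"] that by auto
    moreover have "r \<le> \<Sum>B" if "r \<in> B" for r
      using member_le_sum[of r B "\<lambda>x. x"] p that by auto
    ultimately show "p \<in> Pow {..N} \<times> Pow {..N}"
      using p by fastforce
  qed
qed simp

lemma gf_cong:
  assumes "\<And>R B. finite R \<Longrightarrow> finite B \<Longrightarrow> 0 \<notin> R \<Longrightarrow> 0 \<notin> B \<Longrightarrow> P R B \<longleftrightarrow> Q R B"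
  shows "gf P = gf Q"
proof -
  have "part_pairs P = part_pairs Q"
    using assms by (auto simp: part_pairs_def fun_eq_iff)
  then show ?thesis
    by (simp add: gf_def)
qed

lemma gf_False: "gf (\<lambda>R B. False) = 0"
  by (simp add: gf_def part_pairs_def fps_eq_iff)

lemma gf_swap: "gf P = gf (\<lambda>R B. P B R)"
proof -
  have "bij_betw prod.swap (part_pairs P N) (part_pairs (\<lambda>R B. P B R) N)" for N
    by (rule bij_betw_byWitness[where f' = prod.swap]) (auto simp: part_pairs_def)
  then have "card (part_pairs P N) = card (part_pairs (\<lambda>R B. P B R) N)" for N
    by (rule bij_betw_same_card)
  then show ?thesis
    by (simp add: gf_def)
qed

lemma gf_split_fst:
  assumes "m > 0"
  shows "gf P = gf (\<lambda>R B. m \<notin> R \<and> P R B) +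
    fps_X ^ m * gf (\<lambda>R B. m \<notin> R \<and> P (insert m R) B)"
proof (rule fps_ext)
  fix N
  let ?P0 = "\<lambda>R B. m \<notin> R \<and> P R B" and ?P1 = "\<lambda>R B. m \<in> R \<and> P R B"
    and ?Q = "\<lambda>R B. m \<notin> R \<and> P (insert m R) B"
  have "part_pairs P N = part_pairs ?P0 N \<union> part_pairs ?P1 N"
    "part_pairs ?P0 N \<inter> part_pairs ?P1 N = {}"
    by (auto simp: part_pairs_def)
  then have 1: "card (part_pairs P N) = card (part_pairs ?P0 N) + card (part_pairs ?P1 N)"
    by (simp add: card_Un_disjoint finite_part_pairs)
  have sum: "\<Sum>R = m + \<Sum>(R - {m})" if "finite R" "m \<in> R" for R
    using that by (simp add: sum.remove)
  have 2: "card (part_pairs ?P1 N) = (if N < m then 0 else card (part_pairs ?Q (N - m)))"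
  proof (cases "N < m")
    case True
    then have "part_pairs ?P1 N = {}"
      using sum by (fastforce simp: part_pairs_def)
    then show ?thesis
      using True by simp
  next
    case False
    have "bij_betw (\<lambda>(R, B). (R - {m}, B)) (part_pairs ?P1 N) (part_pairs ?Q (N - m))"
      by (rule bij_betw_byWitness[where f' = "\<lambda>(R, B). (insert m R, B)"])
        (use False assms sum in \<open>fastforce simp: part_pairs_def insert_absorb\<close>)+
    then show ?thesis
      using False by (simp add: bij_betw_same_card)
  qed
  show "fps_nth (gf P) N = fps_nth (gf ?P0 + fps_X ^ m * gf ?Q) N"
    by (simp add: gf_def fps_X_power_mult_nth 1 2)
qed

lemma gf_split_snd:
  assumes "m > 0"
  shows "gf P = gf (\<lambda>R B. m \<notin> B \<and> P R B) +
    fps_X ^ m * gf (\<lambda>R B. m \<notin> B \<and> P R (insert m B))"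
  using gf_split_fst[OF assms, of "\<lambda>R B. P B R"]
  by (simp add: gf_swap[of P] gf_swap[of "\<lambda>R B. m \<notin> R \<and> P B R"]
      gf_swap[of "\<lambda>R B. m \<notin> R \<and> P B (insert m R)"])

text \<open>A part of size at least \<open>m\<close> makes the total at least \<open>m\<close>, so
  the coefficients below \<open>m\<close> only see pairs with all parts smaller than
  \<open>m\<close>.\<close>

lemma X_power_dvd_gf_diff:
  assumes "\<And>R B. finite R \<Longrightarrow> finite B \<Longrightarrow> 0 \<notin> R \<Longrightarrow> 0 \<notin> B \<Longrightarrow>
    \<forall>r\<in>R. r < m \<Longrightarrow> \<forall>b\<in>B. b < m \<Longrightarrow> P R B \<longleftrightarrow> Q R B"
  shows "fps_X ^ m dvd gf P - gf Q"
proof -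
  have "part_pairs P N = part_pairs Q N" if "N < m" for N
  proof -
    have "P R B \<longleftrightarrow> Q R B" if "finite R" "finite B" "0 \<notin> R" "0 \<notin> B" "\<Sum>R + \<Sum>B = N" for R B
    proof -
      have "r \<le> \<Sum>R" if "r \<in> R" for r
        using member_le_sum[of r R "\<lambda>x. x"] that \<open>finite R\<close> by auto
      moreover have "r \<le> \<Sum>B" if "r \<in> B" for r
        using member_le_sum[of r B "\<lambda>x. x"] that \<open>finite B\<close> by auto
      ultimately show ?thesis
        using that \<open>N < m\<close> by (intro assms) fastforce+
    qed
    then show ?thesis
      by (auto simp: part_pairs_def)
  qed
  then show ?thesis
    by (simp add: X_power_dvd_iff gf_def)
qed

lemma gf_empty: "gf (\<lambda>R B. R = {} \<and> B = {}) = 1"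
proof -
  have "part_pairs (\<lambda>R B. R = {} \<and> B = {}) N = (if N = 0 then {({}, {})} else {})" for N
    by (auto simp: part_pairs_def)
  then show ?thesis
    by (simp add: gf_def fps_eq_iff)
qed

text \<open>\<open>\<delta> s r c\<close> is the state that follows \<open>s\<close> when a red part (\<open>r\<close>) and a blue part (\<open>c\<close>) of the
  current size are present or not; \<open>None\<close> rejects. All sizes from \<open>b\<close> on are read, so a pending
  obligation that is never met also leads to rejection.\<close>

coinductive accepts ::
    "('s \<Rightarrow> bool \<Rightarrow> bool \<Rightarrow> 's option) \<Rightarrow> nat set \<Rightarrow> nat set \<Rightarrow> 's \<Rightarrow> nat \<Rightarrow> bool"
  for \<delta> R B where
  "\<delta> s (b \<in> R) (b \<in> B) = Some t \<Longrightarrow> accepts \<delta> R B t (Suc b) \<Longrightarrow> accepts \<delta> R B s b"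

lemma accepts_step:
  "accepts \<delta> R B s b \<longleftrightarrow>
     (case \<delta> s (b \<in> R) (b \<in> B) of None \<Rightarrow> False | Some t \<Rightarrow> accepts \<delta> R B t (Suc b))"
  by (subst accepts.simps) (auto split: option.splits)

lemma accepts_cong_imp:
  assumes "accepts \<delta> R B s b" "\<And>c. c \<ge> b \<Longrightarrow> (c \<in> R \<longleftrightarrow> c \<in> R') \<and> (c \<in> B \<longleftrightarrow> c \<in> B')"
  shows "accepts \<delta> R' B' s b"
proof -
  have "accepts \<delta> R B s b \<and> (\<forall>c\<ge>b. (c \<in> R \<longleftrightarrow> c \<in> R') \<and> (c \<in> B \<longleftrightarrow> c \<in> B'))"
    using assms by blast
  then show ?thesis
  proof (coinduction arbitrary: s b)
    case (accepts s b)
    then have "accepts \<delta> R B s b"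
      by blast
    then obtain t where "\<delta> s (b \<in> R) (b \<in> B) = Some t" "accepts \<delta> R B t (Suc b)"
      by (auto elim: accepts.cases)
    with accepts show ?case
      by auto
  qed
qed

lemma accepts_cong:
  assumes "\<And>c. c \<ge> b \<Longrightarrow> (c \<in> R \<longleftrightarrow> c \<in> R') \<and> (c \<in> B \<longleftrightarrow> c \<in> B')"
  shows "accepts \<delta> R B s b \<longleftrightarrow> accepts \<delta> R' B' s b"
  using assms accepts_cong_imp[of \<delta> R B s b R' B'] accepts_cong_imp[of \<delta> R' B' s b R B] by blast

text \<open>Turns a run into a pointwise condition: \<open>st c\<close> is a closed form for the
  state at size \<open>c\<close>. The transition rule may presuppose \<open>ok\<close> at all
  earlier sizes, since otherwise the run has already been rejected.\<close>

lemma accepts_iff_all: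
  assumes "\<And>c. c \<ge> b \<Longrightarrow> \<forall>d. b \<le> d \<and> d < c \<longrightarrow> ok d \<Longrightarrow>
    \<delta> (st c) (c \<in> R) (c \<in> B) = (if ok c then Some (st (Suc c)) else None)"
  shows "accepts \<delta> R B (st b) b \<longleftrightarrow> (\<forall>c\<ge>b. ok c)"
proof
  assume acc: "accepts \<delta> R B (st b) b"
  have "accepts \<delta> R B (st c) c \<and> (\<forall>d. b \<le> d \<and> d < c \<longrightarrow> ok d)" if "c \<ge> b" for c
    using that
  proof (induction c rule: dec_induct)
    case base
    show ?case
      using acc by auto
  next
    case (step c)
    then have "ok c \<and> accepts \<delta> R B (st (Suc c)) (Suc c)"
      using assms[of c] accepts_step[of \<delta> R B "st c" c] by (auto split: if_splits)
    then show ?case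
      using step by (auto simp: less_Suc_eq)
  qed
  then show "\<forall>c\<ge>b. ok c"
    by (meson le_Suc_eq lessI)
next
  assume ok: "\<forall>c\<ge>b. ok c"
  have "\<exists>c\<ge>b. s = st c \<and> d = c \<Longrightarrow> accepts \<delta> R B s d" for s d
  proof (coinduction arbitrary: s d)
    case (accepts s d)
    then show ?case
      using assms[of d] ok by auto
  qed
  then show "accepts \<delta> R B (st b) b"
    by blast
qed

section \<open>The linear system of an automaton and the uniqueness of its solution\<close>

definition suffix_gf :: "('s \<Rightarrow> bool \<Rightarrow> bool \<Rightarrow> 's option) \<Rightarrow> nat \<Rightarrow> 's \<Rightarrow> int fps" where
  "suffix_gf \<delta> b s = gf (\<lambda>R B. R \<subseteq> {b..} \<and> B \<subseteq> {b..} \<and> accepts \<delta> R B s b)"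

text \<open>Right-hand side of the linear system solved by \<open>suffix_gf\<close>. It takes an
  arbitrary family \<open>U\<close>, so that a conjectured closed form can be tested against the
  same system.\<close>

definition transfer ::
    "('s \<Rightarrow> bool \<Rightarrow> bool \<Rightarrow> 's option) \<Rightarrow> (nat \<Rightarrow> 's \<Rightarrow> int fps) \<Rightarrow> nat \<Rightarrow> 's \<Rightarrow> int fps" where
  "transfer \<delta> U b s =
     (let V = (\<lambda>r c. case \<delta> s r c of None \<Rightarrow> 0 | Some t \<Rightarrow> U (Suc b) t)
      in V False False + fps_X ^ b * V True False + fps_X ^ b * V False True +
         fps_X ^ (2 * b) * V True True)"

lemma suffix_gf_transfer:
  assumes "b > 0"
  shows "suffix_gf \<delta> b s = transfer \<delta> (suffix_gf \<delta>) b s"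
proof -
  define V where "V = (\<lambda>r c. case \<delta> s r c of None \<Rightarrow> 0 | Some t \<Rightarrow> suffix_gf \<delta> (Suc b) t)"
  \<comment> \<open>One statement for all four choices at size \<open>b\<close>: reading
    \<open>b\<close> selects the next state, and acceptance from \<open>Suc b\<close> on no longer
    depends on whether \<open>b\<close> was inserted.\<close>
  have V: "gf (\<lambda>R B. R \<subseteq> {Suc b..} \<and> B \<subseteq> {Suc b..} \<and>
      accepts \<delta> (if r then insert b R else R) (if c then insert b B else B) s b) = V r c"
    (is "gf ?P = _") for r c
  proof -
    have "accepts \<delta> (if r then insert b R else R) (if c then insert b B else B) s b \<longleftrightarrow>
        (case \<delta> s r c of None \<Rightarrow> False | Some t \<Rightarrow> accepts \<delta> R B t (Suc b))"
      if "R \<subseteq> {Suc b..}" "B \<subseteq> {Suc b..}" for R B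
    proof -
      have mem: "b \<in> (if r then insert b R else R) \<longleftrightarrow> r" "b \<in> (if c then insert b B else B) \<longleftrightarrow> c"
        using that by auto
      have "accepts \<delta> (if r then insert b R else R) (if c then insert b B else B) t (Suc b) \<longleftrightarrow>
          accepts \<delta> R B t (Suc b)" for t
        by (rule accepts_cong) auto
      then show ?thesis
        by (subst accepts_step) (simp only: mem)
    qed
    then have "gf ?P = gf (\<lambda>R B. R \<subseteq> {Suc b..} \<and> B \<subseteq> {Suc b..} \<and>
        (case \<delta> s r c of None \<Rightarrow> False | Some t \<Rightarrow> accepts \<delta> R B t (Suc b)))"
      by (intro gf_cong) blast
    then show ?thesis
      by (simp add: V_def suffix_gf_def gf_False split: option.split)
  qed
  have sub: "b \<notin> R \<and> R \<subseteq> {b..} \<longleftrightarrow> R \<subseteq> {Suc b..}" for R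
    by (auto simp: subset_iff Suc_le_eq order_less_le)
  let ?A = "\<lambda>R B. R \<subseteq> {b..} \<and> B \<subseteq> {b..} \<and> accepts \<delta> R B s b"
  have "gf ?A = gf (\<lambda>R B. b \<notin> R \<and> ?A R B) + fps_X ^ b * gf (\<lambda>R B. b \<notin> R \<and> ?A (insert b R) B)"
    by (rule gf_split_fst[OF assms])
  also have "gf (\<lambda>R B. b \<notin> R \<and> ?A R B) = gf (\<lambda>R B. b \<notin> B \<and> b \<notin> R \<and> ?A R B) +
      fps_X ^ b * gf (\<lambda>R B. b \<notin> B \<and> b \<notin> R \<and> ?A R (insert b B))"
    by (rule gf_split_snd[OF assms])
  also have "gf (\<lambda>R B. b \<notin> R \<and> ?A (insert b R) B) =
      gf (\<lambda>R B. b \<notin> B \<and> b \<notin> R \<and> ?A (insert b R) B) +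
      fps_X ^ b * gf (\<lambda>R B. b \<notin> B \<and> b \<notin> R \<and> ?A (insert b R) (insert b B))"
    by (rule gf_split_snd[OF assms])
  \<comment> \<open>The constant conditionals bring the four summands into the shape of the
    left-hand side of \<open>V\<close>.\<close>
  also have "(\<lambda>R B. b \<notin> B \<and> b \<notin> R \<and> ?A R B) = (\<lambda>R B. R \<subseteq> {Suc b..} \<and> B \<subseteq> {Suc b..} \<and>
      accepts \<delta> (if False then insert b R else R) (if False then insert b B else B) s b)"
    by (auto simp: fun_eq_iff sub[symmetric])
  also have "(\<lambda>R B. b \<notin> B \<and> b \<notin> R \<and> ?A R (insert b B)) = (\<lambda>R B. R \<subseteq> {Suc b..} \<and> B \<subseteq> {Suc b..} \<and>
      accepts \<delta> (if False then insert b R else R) (if True then insert b B else B) s b)"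
    by (auto simp: fun_eq_iff sub[symmetric])
  also have "(\<lambda>R B. b \<notin> B \<and> b \<notin> R \<and> ?A (insert b R) B) = (\<lambda>R B. R \<subseteq> {Suc b..} \<and> B \<subseteq> {Suc b..} \<and>
      accepts \<delta> (if True then insert b R else R) (if False then insert b B else B) s b)"
    by (auto simp: fun_eq_iff sub[symmetric])
  also have "(\<lambda>R B. b \<notin> B \<and> b \<notin> R \<and> ?A (insert b R) (insert b B)) =
      (\<lambda>R B. R \<subseteq> {Suc b..} \<and> B \<subseteq> {Suc b..} \<and>
        accepts \<delta> (if True then insert b R else R) (if True then insert b B else B) s b)"
    by (auto simp: fun_eq_iff sub[symmetric])
  finally have "gf ?A = V False False + fps_X ^ b * V False True +
      fps_X ^ b * (V True False + fps_X ^ b * V True True)"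
    unfolding V .
  then show ?thesis
    by (simp add: suffix_gf_def transfer_def V_def Let_def mult_2 power_add distrib_left mult.assoc add_ac)
qed

text \<open>Every part contributes at least \<open>b\<close>, so modulo \<open>fps_X ^ b\<close>
  only the empty pair counts.\<close>

lemma X_power_dvd_suffix_gf:
  "fps_X ^ b dvd suffix_gf \<delta> b s - of_bool (accepts \<delta> {} {} s b)"
proof -
  have "of_bool (accepts \<delta> {} {} s b) =
      gf (\<lambda>R B. (R = {} \<and> B = {}) \<and> accepts \<delta> {} {} s b)"
    by (cases "accepts \<delta> {} {} s b") (simp_all add: gf_empty gf_False)
  moreover have "fps_X ^ b dvd gf (\<lambda>R B. R \<subseteq> {b..} \<and> B \<subseteq> {b..} \<and> accepts \<delta> R B s b) -
      gf (\<lambda>R B. (R = {} \<and> B = {}) \<and> accepts \<delta> {} {} s b)"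
  proof (rule X_power_dvd_gf_diff)
    fix R B :: "nat set"
    assume "\<forall>r\<in>R. r < b" "\<forall>c\<in>B. c < b"
    then have "R \<subseteq> {b..} \<longleftrightarrow> R = {}" "B \<subseteq> {b..} \<longleftrightarrow> B = {}"
      by fastforce+
    then show "R \<subseteq> {b..} \<and> B \<subseteq> {b..} \<and> accepts \<delta> R B s b \<longleftrightarrow>
        (R = {} \<and> B = {}) \<and> accepts \<delta> {} {} s b"
      by blast
  qed
  ultimately show ?thesis
    by (simp add: suffix_gf_def)
qed

text \<open>\<open>transfer\<close> is linear and refers only to size \<open>Suc b\<close>, so the
  difference of two solutions is again a solution and the descent makes it vanish. The base
  condition fixes the constant terms, which the system alone does not determine.\<close>

lemma suffix_gf_eqI:
  assumes base: "\<And>b s. b > 0 \<Longrightarrow> fps_X ^ b dvd U b s - of_bool (accepts \<delta> {} {} s b)"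
    and step: "\<And>b s. b > 0 \<Longrightarrow> U b s = transfer \<delta> U b s"
    and "b > 0"
  shows "suffix_gf \<delta> b s = U b s"
proof (rule X_power_dvd_imp_eq)
  fix m
  show "fps_X ^ m dvd suffix_gf \<delta> b s - U b s"
  proof (rule X_power_dvd_descent[where D = "\<lambda>b s. suffix_gf \<delta> b s - U b s"])
    fix b :: nat and s assume "b > 0"
    then show "fps_X ^ b dvd suffix_gf \<delta> b s - U b s"
      using dvd_diff[OF X_power_dvd_suffix_gf base, of b \<delta> s s] by simp
  next
    fix b :: nat and s
    assume b: "b > 0" and IH: "\<And>c t. c > b \<Longrightarrow> fps_X ^ m dvd suffix_gf \<delta> c t - U c t"
    let ?D = "\<lambda>b s. suffix_gf \<delta> b s - U b s"
    have "?D b s = transfer \<delta> (suffix_gf \<delta>) b s - transfer \<delta> U b s"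
      using b by (simp add: suffix_gf_transfer[symmetric] step[symmetric])
    also have "\<dots> = transfer \<delta> ?D b s"
      by (simp add: transfer_def Let_def algebra_simps split: option.split)
    also have "fps_X ^ m dvd \<dots>"
      unfolding transfer_def Let_def
      by (intro dvd_add dvd_mult) (auto split: option.split intro: IH)
    finally show "fps_X ^ m dvd ?D b s" .
  qed fact
qed

subsection \<open>Partitions with parts repeated at most three times\<close>

definition distinct_step :: "unit \<Rightarrow> bool \<Rightarrow> bool \<Rightarrow> unit option" where
  "distinct_step s r c = (if r then None else Some ())"

lemma accepts_distinct_step: "accepts distinct_step R B () b \<longleftrightarrow> R \<inter> {b..} = {}"
proof -
  have "accepts distinct_step R B () b \<longleftrightarrow> (\<forall>c\<ge>b. c \<notin> R)"
    by (rule accepts_iff_all) (simp add: distinct_step_def)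
  then show ?thesis
    by auto
qed

text \<open>As \<open>j\<close> grows, y = q^j tends to 0 and F(w,y) to the product of the 1 + w
  q^k. Modulo \<open>fps_X ^ j\<close> the last term of \<open>lebesgue_rec\<close> disappears,
  which leaves the recurrence for distinct blue parts from \<open>b\<close> on.\<close>

lemma X_power_dvd_lebesgue_distinct:
  assumes "b > 0"
  shows "fps_X ^ j dvd lebesgue b j - suffix_gf distinct_step b s"
proof (rule X_power_dvd_descent[where D = "\<lambda>b s. lebesgue b j - suffix_gf distinct_step b s"])
  fix b :: nat and s
  have "fps_X ^ b dvd suffix_gf distinct_step b s - 1"
    using X_power_dvd_suffix_gf[of b distinct_step s] by (simp add: accepts_distinct_step)
  from dvd_diff[OF X_power_dvd_lebesgue this, of j]
  show "fps_X ^ b dvd lebesgue b j - suffix_gf distinct_step b s"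
    by simp
next
  fix b :: nat and s
  assume b: "b > 0"
    and IH: "\<And>c t. c > b \<Longrightarrow> fps_X ^ j dvd lebesgue c j - suffix_gf distinct_step c t"
  have "lebesgue b j - suffix_gf distinct_step b s =
      (1 + fps_X ^ b) * (lebesgue (b + 1) j - suffix_gf distinct_step (b + 1) s) +
      fps_X ^ j * (fps_X ^ b * lebesgue (b + 2) j)"
    using b by (subst lebesgue_rec, subst suffix_gf_transfer)
      (simp_all add: transfer_def distinct_step_def power_add algebra_simps)
  also have "fps_X ^ j dvd \<dots>"
    using IH[of "b + 1" s] by (intro dvd_add dvd_mult[of _ _ "1 + fps_X ^ b"] dvd_triv_left) simp
  finally show "fps_X ^ j dvd lebesgue b j - suffix_gf distinct_step b s" .
qed fact

text \<open>For odd \<open>j\<close>, \<open>K j\<close> obeys the same two-step recurrence as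
  \<open>lebesgue 1 j\<close>, and both approach the generating function of distinct blue parts as
  \<open>j\<close> grows. So they agree at \<open>j = 1\<close>, where \<open>K\<close> admits all
  even red parts.\<close>

lemma gf_even_fst: "gf (\<lambda>R B. \<forall>r\<in>R. even r) = lebesgue 1 1"
proof (rule X_power_dvd_imp_eq)
  fix m
  define K where "K j = gf (\<lambda>R B. \<forall>r\<in>R. even r \<and> j < r)" for j :: nat
  have K_step: "K j = (1 + fps_X ^ (j + 1)) * K (j + 2)" if "odd j" for j
  proof -
    have "(even r \<and> j < r) \<longleftrightarrow> r = j + 1 \<or> (even r \<and> j + 2 < r)" for r
      using that by presburger
    then have "gf (\<lambda>R B. j + 1 \<notin> R \<and> (\<forall>r\<in>R. even r \<and> j < r)) = K (j + 2)"
        "gf (\<lambda>R B. j + 1 \<notin> R \<and> (\<forall>r\<in>insert (j + 1) R. even r \<and> j < r)) = K (j + 2)"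
      unfolding K_def by (intro gf_cong; force)+
    with gf_split_fst[of "j + 1" "\<lambda>R B. \<forall>r\<in>R. even r \<and> j < r"] show ?thesis
      by (simp add: K_def algebra_simps)
  qed
  \<comment> \<open>If all parts are below \<open>j\<close>, the red set must be empty and the blue
    set is arbitrary.\<close>
  have K_dvd: "fps_X ^ j dvd K j - suffix_gf distinct_step 1 ()" for j
    unfolding K_def suffix_gf_def accepts_distinct_step
  proof (rule X_power_dvd_gf_diff, goal_cases)
    case (1 R B)
    have "R \<subseteq> {1..}" "B \<subseteq> {1..}"
      using 1 by (auto simp: subset_iff Suc_le_eq intro!: gr0I)
    moreover have "(\<forall>r\<in>R. even r \<and> j < r) \<longleftrightarrow> R = {}"
      using 1 by force
    ultimately show ?case
      by blast
  qed
  \<comment> \<open>Odd second arguments are written \<open>2 * k - 1\<close>, so that one step of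
    the descent in \<open>k\<close> raises them by 2.\<close>
  have "fps_X ^ m dvd K (2 * 1 - 1) - lebesgue 1 (2 * 1 - 1)"
  proof (rule X_power_dvd_descent[where D = "\<lambda>k (_ :: unit). K (2 * k - 1) - lebesgue 1 (2 * k - 1)"])
    fix k :: nat assume "k > 0"
    have "fps_X ^ (2 * k - 1) dvd K (2 * k - 1) - lebesgue 1 (2 * k - 1)"
      using dvd_diff[OF K_dvd X_power_dvd_lebesgue_distinct, of 1 "2 * k - 1" "()"] by simp
    then show "fps_X ^ k dvd K (2 * k - 1) - lebesgue 1 (2 * k - 1)"
      by (rule dvd_trans[rotated]) (use \<open>k > 0\<close> in \<open>simp add: le_imp_power_dvd\<close>)
  next
    fix k :: nat
    assume k: "k > 0"
      and IH: "\<And>c t. c > k \<Longrightarrow> fps_X ^ m dvd K (2 * c - 1) - lebesgue 1 (2 * c - 1)"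
    have "K (2 * k - 1) - lebesgue 1 (2 * k - 1) =
        (1 + fps_X ^ (2 * k - 1 + 1)) * (K (2 * k - 1 + 2) - lebesgue 1 (2 * k - 1 + 2))"
      using k by (subst K_step, simp, subst lebesgue_1_step) (simp add: algebra_simps)
    moreover have "2 * k - 1 + 2 = 2 * Suc k - 1"
      using k by simp
    ultimately show "fps_X ^ m dvd K (2 * k - 1) - lebesgue 1 (2 * k - 1)"
      using IH[of "Suc k"] by (metis dvd_mult lessI)
  qed simp
  moreover have "K 1 = gf (\<lambda>R B. \<forall>r\<in>R. even r)"
    unfolding K_def
  proof (rule gf_cong)
    fix R :: "nat set"
    assume "0 \<notin> R"
    moreover have "even r \<and> 1 < r \<longleftrightarrow> even r \<and> r \<noteq> 0" for r :: nat
      by presburger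
    ultimately show "(\<forall>r\<in>R. even r \<and> 1 < r) \<longleftrightarrow> (\<forall>r\<in>R. even r)"
      by metis
  qed
  ultimately show "fps_X ^ m dvd gf (\<lambda>R B. \<forall>r\<in>R. even r) - lebesgue 1 1"
    by simp
qed

subsection \<open>Matched bicolored partitions\<close>

definition matchable :: "nat set \<Rightarrow> nat set \<Rightarrow> bool" where
  "matchable R B \<longleftrightarrow> (\<exists>f. inj_on f R \<and> (\<forall>b\<in>R. f b \<in> B \<and> (f b = b \<or> f b = b + 1)))"

text \<open>State \<open>p\<close> means that the red part one size below still awaits a partner. A
  blue part of the current size serves it first; the current red part is left waiting if that blue
  part is absent or already taken.\<close>

definition matching_step :: "bool \<Rightarrow> bool \<Rightarrow> bool \<Rightarrow> bool option" where
  "matching_step p r c = (if p \<and> \<not> c then None else Some (r \<and> (p \<or> \<not> c)))"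

text \<open>Greedy matching: \<open>pending R B c\<close> says that the red part \<open>c - 1\<close> could not take the blue
  part \<open>c - 1\<close>, so that the blue part \<open>c\<close> has to be present and is reserved for it.\<close>

primrec pending :: "nat set \<Rightarrow> nat set \<Rightarrow> nat \<Rightarrow> bool" where
  "pending R B 0 = False"
| "pending R B (Suc c) = (c \<in> R \<and> (pending R B c \<or> c \<notin> B))"

text \<open>The greedy choice is optimal: by induction every admissible \<open>f\<close> must send a
  red part up whenever the greedy matching does. Conversely the greedy map itself is a
  witness.\<close>

lemma matchable_iff_pending: "matchable R B \<longleftrightarrow> (\<forall>c. pending R B c \<longrightarrow> c \<in> B)"
proof
  assume "matchable R B"
  then obtain f where inj: "inj_on f R"
    and f: "\<And>b. b \<in> R \<Longrightarrow> f b \<in> B \<and> (f b = b \<or> f b = b + 1)"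
    unfolding matchable_def by blast
  have forced: "pending R B c \<Longrightarrow> c > 0 \<and> c - 1 \<in> R \<and> f (c - 1) = c" for c
  proof (induction c)
    case (Suc c)
    then have c: "c \<in> R"
      by simp
    have "f c \<noteq> c"
    proof (cases "pending R B c")
      case True
      then have "c > 0" "c - 1 \<in> R" "f (c - 1) = c"
        using Suc.IH by auto
      then show ?thesis
        using inj_onD[OF inj, of "c - 1" c] c by auto
    next
      case False
      then show ?thesis
        using Suc.prems f[OF c] by auto
    qed
    then show ?case
      using f[OF c] c by simp
  qed simp
  show "\<forall>c. pending R B c \<longrightarrow> c \<in> B"
    using forced f by metis
next
  assume pend: "\<forall>c. pending R B c \<longrightarrow> c \<in> B"
  define f where "f b = (if b \<in> B \<and> \<not> pending R B b then b else b + 1)" for b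
  \<comment> \<open>A collision needs \<open>c = b + 1\<close>, with \<open>b\<close> sent up and
    \<open>c\<close> fixed; but then \<open>c\<close> is pending and is sent up as well.\<close>
  have "f b \<noteq> f c" if "b < c" "b \<in> R" for b c
    using that by (auto simp: f_def dest!: less_imp_Suc_add)
  then have "inj_on f R"
    by (metis inj_onI linorder_neqE_nat)
  moreover have "f b \<in> B" if "b \<in> R" for b
    using pend[rule_format, of "Suc b"] that by (auto simp: f_def)
  ultimately show "matchable R B"
    unfolding matchable_def by (intro exI[of _ f]) (auto simp: f_def)
qed

lemma accepts_matching_step:
  assumes "0 \<notin> R"
  shows "accepts matching_step R B False 1 \<longleftrightarrow> matchable R B"
proof -
  have "accepts matching_step R B (pending R B 1) 1 \<longleftrightarrow> (\<forall>c\<ge>1. pending R B c \<longrightarrow> c \<in> B)"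
    by (rule accepts_iff_all) (auto simp: matching_step_def)
  moreover have "pending R B c \<Longrightarrow> c \<ge> 1" for c
    by (cases c) auto
  ultimately show ?thesis
    using assms by (auto simp: matchable_iff_pending)
qed

text \<open>In the waiting state the blue part \<open>b\<close> is compulsory, whence the factor
  \<open>fps_X ^ b\<close>; the rest is \<open>lebesgue_shift\<close> at \<open>b + 1\<close> and
  \<open>b\<close>. The other state combines the shift at \<open>b\<close> and \<open>b\<close> with
  \<open>lebesgue_rec\<close> at \<open>b\<close> and \<open>b + 1\<close>.\<close>

lemma suffix_gf_matching_step:
  assumes "b > 0"
  shows "suffix_gf matching_step b p = (if p then fps_X ^ b * lebesgue (b + 1) b else lebesgue b b)"
  using _ _ assms
proof (rule suffix_gf_eqI)
  fix b :: nat and p :: bool assume "b > 0"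
  have "accepts matching_step {} {} False b"
    using accepts_iff_all[of b "\<lambda>_. True" matching_step "\<lambda>_. False" "{}" "{}"]
    by (simp add: matching_step_def)
  moreover have "\<not> accepts matching_step {} {} True b"
    by (subst accepts_step) (simp add: matching_step_def)
  ultimately show "fps_X ^ b dvd (if p then fps_X ^ b * lebesgue (b + 1) b else lebesgue b b) -
      of_bool (accepts matching_step {} {} p b)"
    using X_power_dvd_lebesgue[of b b] by (cases p) simp_all
next
  fix b :: nat and p :: bool assume "b > 0"
  let ?U = "\<lambda>b p. if p then fps_X ^ b * lebesgue (b + 1) b else lebesgue b b"
  show "?U b p = transfer matching_step ?U b p"
  proof (cases p)
    case True
    then show ?thesis
      using lebesgue_shift[of "b + 1" b]
      by (simp add: transfer_def matching_step_def mult_2 mult_2_right power_add algebra_simps)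
  next
    case False
    then show ?thesis
      using lebesgue_shift[OF \<open>b > 0\<close>, of b] lebesgue_rec[of b "b + 1"]
      by (simp add: transfer_def matching_step_def mult_2 mult_2_right power_add algebra_simps)
  qed
qed

lemma gf_matchable: "gf matchable = lebesgue 1 1"
proof -
  have "gf matchable = suffix_gf matching_step 1 False"
    unfolding suffix_gf_def
  proof (rule gf_cong)
    fix R B :: "nat set"
    assume "0 \<notin> R" "0 \<notin> B"
    then have "R \<subseteq> {1..}" "B \<subseteq> {1..}"
      by (auto simp: subset_iff Suc_le_eq intro!: gr0I)
    with accepts_matching_step[OF \<open>0 \<notin> R\<close>]
    show "matchable R B \<longleftrightarrow> R \<subseteq> {1..} \<and> B \<subseteq> {1..} \<and> accepts matching_step R B False 1"
      by blast
  qed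
  then show ?thesis
    by (simp add: suffix_gf_matching_step)
qed

subsection \<open>Run-free bicolored partitions\<close>

text \<open>\<open>forbidden_run\<close> without the demand that \<open>b\<close> be blue: it then
  depends only on parts below \<open>b\<close> and can be tracked before \<open>b\<close> is
  read.\<close>

definition bad_run :: "nat set \<Rightarrow> nat set \<Rightarrow> nat \<Rightarrow> nat \<Rightarrow> bool" where
  "bad_run R B b k \<longleftrightarrow>
     1 \<le> k \<and> 2 * k \<le> b \<and> b - 2 * k + 1 \<in> R \<and>
     (\<forall>j\<in>{1..k - 1}. b - 2 * j \<in> R) \<and> (\<forall>c\<in>{b - 2 * k + 1..<b}. c \<notin> B)"

definition run_free :: "nat set \<Rightarrow> nat set \<Rightarrow> bool" where
  "run_free R B \<longleftrightarrow>
     1 \<notin> R \<and> (\<forall>b\<in>B. b + 1 \<notin> R \<and> b + 2 \<notin> R) \<and> (\<forall>b\<in>B. \<forall>k. \<not> bad_run R B b k)"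

text \<open>Says that a blue part of the given size would complete a run. The last difference is 1,
  after a lone red part, or 2, after a red part that itself ends a shorter run; hence the recursion
  in steps of two.\<close>

fun danger :: "nat set \<Rightarrow> nat set \<Rightarrow> nat \<Rightarrow> bool" where
  "danger R B 0 = False"
| "danger R B (Suc 0) = False"
| "danger R B (Suc (Suc b)) =
     (Suc b \<notin> B \<and> (Suc b \<in> R \<or> (b \<in> R \<and> b \<notin> B \<and> danger R B b)))"

lemma bad_run_1: "bad_run R B (Suc (Suc b)) 1 \<longleftrightarrow> Suc b \<notin> B \<and> Suc b \<in> R"
  by (auto simp: bad_run_def)

lemma bad_run_Suc:
  assumes "k \<ge> 1"
  shows "bad_run R B (Suc (Suc b)) (Suc k) \<longleftrightarrow>
    Suc b \<notin> B \<and> b \<in> R \<and> b \<notin> B \<and> bad_run R B b k"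
proof (cases "2 * k \<le> b")
  case True
  have "{b - 2 * k + 1..<Suc (Suc b)} = {b - 2 * k + 1..<b} \<union> {b, Suc b}"
    using True assms by auto
  moreover have "{1..k} = insert 1 (Suc ` {1..k - 1})"
    using assms by (auto simp: image_iff Bex_def)
  then have "(\<forall>j\<in>{1..k}. Suc (Suc b) - 2 * j \<in> R) \<longleftrightarrow> b \<in> R \<and> (\<forall>j\<in>{1..k - 1}. b - 2 * j \<in> R)"
    by (simp del: image_Suc_atLeastAtMost)
  ultimately show ?thesis
    using True assms by (auto simp: bad_run_def)
next
  case False
  then show ?thesis
    by (auto simp: bad_run_def)
qed

lemma danger_iff_bad_run: "danger R B b \<longleftrightarrow> (\<exists>k. bad_run R B b k)"
proof (induction R B b rule: danger.induct)
  case (3 R B b)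
  have split: "k = 1 \<or> (\<exists>k'\<ge>1. k = Suc k')" if "bad_run R B c k" for c k
    using that by (cases k) (auto simp: bad_run_def Suc_le_eq)
  have "(\<exists>k. bad_run R B (Suc (Suc b)) k) \<longleftrightarrow>
      bad_run R B (Suc (Suc b)) 1 \<or> (\<exists>k\<ge>1. bad_run R B (Suc (Suc b)) (Suc k))"
    using split by blast
  also have "(\<exists>k\<ge>1. bad_run R B (Suc (Suc b)) (Suc k)) \<longleftrightarrow>
      Suc b \<notin> B \<and> b \<in> R \<and> b \<notin> B \<and> (\<exists>k. bad_run R B b k)"
    using bad_run_Suc[of _ R B b] bad_run_def[of R B b] by metis
  also have "bad_run R B (Suc (Suc b)) 1 \<or> \<dots> \<longleftrightarrow> danger R B (Suc (Suc b))"
    unfolding bad_run_1 3[symmetric] by auto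
  finally show ?case
    by simp
qed (auto simp: bad_run_def)

text \<open>The two \<open>After\<close> states remember a blue part one or two sizes back, which
  bars a red part now. In the two \<open>Danger\<close> states a blue part now would complete a
  forbidden run.\<close>

datatype run_state = Free | After_Blue | After_Blue_Gap | Danger | Danger_Run

fun run_step :: "run_state \<Rightarrow> bool \<Rightarrow> bool \<Rightarrow> run_state option" where
  "run_step Free r c = Some (if c then After_Blue else if r then Danger else Free)"
| "run_step After_Blue r c =
     (if r then None else Some (if c then After_Blue else After_Blue_Gap))"
| "run_step After_Blue_Gap r c = (if r then None else Some (if c then After_Blue else Free))"
| "run_step Danger r c = (if c then None else Some (if r then Danger_Run else Free))"
| "run_step Danger_Run r c = (if c then None else Some (if r then Danger_Run else Danger))"

text \<open>The state \<open>After_Blue_Gap\<close> also serves as the initial one, since it forbids a red part next.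
  \<open>Danger\<close> and \<open>Danger_Run\<close> differ in whether skipping the current size keeps the danger alive.\<close>

definition state_before :: "nat set \<Rightarrow> nat set \<Rightarrow> nat \<Rightarrow> run_state" where
  "state_before R B c =
     (if c - 1 \<in> B then After_Blue
      else if c = 1 \<or> c - 2 \<in> B then After_Blue_Gap
      else if \<not> danger R B c then Free
      else if c - 1 \<in> R \<and> danger R B (c - 1) then Danger_Run
      else Danger)"

lemma accepts_run_step:
  assumes "0 \<notin> R" "0 \<notin> B"
  shows "accepts run_step R B After_Blue_Gap 1 \<longleftrightarrow> run_free R B"
proof -
  \<comment> \<open>At \<open>c = 1\<close> both subtractions give 0, which is harmless because
    \<open>0\<close> is not in \<open>B\<close>; the ban on a red 1 is stated separately.\<close>
  define ok where "ok c \<longleftrightarrow>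
    (c \<in> R \<longrightarrow> c \<noteq> 1 \<and> c - 1 \<notin> B \<and> c - 2 \<notin> B) \<and> (c \<in> B \<longrightarrow> \<not> danger R B c)" for c
  have "accepts run_step R B (state_before R B 1) 1 \<longleftrightarrow> (\<forall>c\<ge>1. ok c)"
  proof (rule accepts_iff_all)
    fix c assume "1 \<le> c" and before: "\<forall>d. 1 \<le> d \<and> d < c \<longrightarrow> ok d"
    show "run_step (state_before R B c) (c \<in> R) (c \<in> B) =
        (if ok c then Some (state_before R B (Suc c)) else None)"
    proof (cases "c = 1")
      case True
      then show ?thesis
        using assms by (simp add: state_before_def ok_def numeral_2_eq_2)
    next
      case False
      with \<open>1 \<le> c\<close> obtain d where c: "c = Suc (Suc d)"
        by (metis One_nat_def Suc_le_D not0_implies_Suc)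
      \<comment> \<open>The only use of the earlier sizes: after a blue \<open>d\<close> there is no
        red \<open>Suc d\<close>, so \<open>After_Blue_Gap\<close> carries no danger and may read a
        blue part.\<close>
      have "Suc d \<in> R \<longrightarrow> d \<notin> B"
        using before[rule_format, of "Suc d"] c by (auto simp: ok_def)
      then show ?thesis
        by (auto simp: state_before_def ok_def c)
    qed
  qed
  moreover have "(\<forall>c\<ge>1. ok c) \<longleftrightarrow> run_free R B"
  proof
    assume ok: "\<forall>c\<ge>1. ok c"
    have "b + 1 \<notin> R \<and> b + 2 \<notin> R \<and> \<not> danger R B b" if "b \<in> B" for b
      using ok[rule_format, of b] ok[rule_format, of "b + 1"] ok[rule_format, of "b + 2"]
        that assms by (cases "b = 0") (auto simp: ok_def)
    moreover have "1 \<notin> R"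
      using ok by (auto simp: ok_def)
    ultimately show "run_free R B"
      by (auto simp: run_free_def danger_iff_bad_run)
  next
    assume free: "run_free R B"
    show "\<forall>c\<ge>1. ok c"
    proof (intro allI impI)
      fix c :: nat assume "c \<ge> 1"
      have "c - 1 \<notin> B" if "c \<in> R"
        using free that \<open>c \<ge> 1\<close> unfolding run_free_def by (metis le_add_diff_inverse2)
      moreover have "c - 2 \<notin> B" if "c \<in> R"
      proof (cases "c \<ge> 2")
        case True
        then show ?thesis
          using free that unfolding run_free_def by (metis le_add_diff_inverse2)
      next
        case False
        then have "c - 2 = 0"
          by simp
        then show ?thesis
          using assms by simp
      qed
      ultimately show "ok c"
        using free by (auto simp: ok_def run_free_def danger_iff_bad_run)
    qed
  qed
  moreover have "state_before R B 1 = After_Blue_Gap"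
    using assms by (simp add: state_before_def)
  ultimately show ?thesis
    by simp
qed

text \<open>The pairs \<open>After_Blue\<close>, \<open>Danger_Run\<close> and \<open>After_Blue_Gap\<close>, \<open>Danger\<close> obey the same
  recurrences with the two colors exchanged, hence the coincidences below.\<close>

lemma suffix_gf_run_step:
  assumes "b > 0"
  shows "suffix_gf run_step b s = (case s of
      Free \<Rightarrow> lebesgue b 1 + fps_X ^ b * lebesgue b 2
    | After_Blue \<Rightarrow> lebesgue b 2
    | After_Blue_Gap \<Rightarrow> lebesgue b 1
    | Danger \<Rightarrow> lebesgue b 1
    | Danger_Run \<Rightarrow> lebesgue b 2)"
    (is "_ = ?U b s")
  using _ _ assms
proof (rule suffix_gf_eqI)
  fix b :: nat and s assume "b > 0"
  \<comment> \<open>Without further parts every state falls back to \<open>Free\<close> within two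
    sizes and stays there, so no state carries a pending obligation.\<close>
  have Free: "accepts run_step {} {} Free b" for b
    using accepts_iff_all[of b "\<lambda>_. True" run_step "\<lambda>_. Free" "{}" "{}"] by simp
  have Gap: "accepts run_step {} {} After_Blue_Gap b" "accepts run_step {} {} Danger b" for b
    by (subst accepts_step, simp add: Free)+
  have "accepts run_step {} {} After_Blue b" "accepts run_step {} {} Danger_Run b" for b
    by (subst accepts_step, simp add: Gap)+
  with Free Gap have "accepts run_step {} {} s b"
    by (cases s) auto
  moreover have "fps_X ^ b dvd ?U b s - 1"
    using X_power_dvd_lebesgue[of b 1] X_power_dvd_lebesgue[of b 2]
      dvd_add[OF X_power_dvd_lebesgue[of b 1] dvd_triv_left[of "fps_X ^ b" "lebesgue b 2"]]
    by (cases s) (simp_all add: algebra_simps)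
  ultimately show "fps_X ^ b dvd ?U b s - of_bool (accepts run_step {} {} s b)"
    by simp
next
  fix b :: nat and s assume "b > 0"
  \<comment> \<open>Equation \<open>2\<close> is the system at \<open>After_Blue\<close>, and
    \<open>1\<close> is the system at \<open>After_Blue_Gap\<close>; the equation at
    \<open>Free\<close> is \<open>1\<close> plus \<open>fps_X ^ b\<close> times
    \<open>2\<close>.\<close>
  have 2: "lebesgue b 2 = lebesgue (Suc b) 1 + fps_X ^ b * lebesgue (Suc b) 2"
    using lebesgue_rec[of b 2] lebesgue_shift[of "b + 1" 1]
    by (simp add: numeral_2_eq_2 algebra_simps)
  have 1: "lebesgue b 1 = lebesgue (Suc b) 1 + fps_X ^ Suc b * lebesgue (Suc b) 2 +
      fps_X ^ b * lebesgue (Suc b) 2"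
    using lebesgue_shift[OF \<open>b > 0\<close>, of 1] 2 by (simp add: numeral_2_eq_2 algebra_simps)
  show "?U b s = transfer run_step ?U b s"
  proof (cases s)
    case Free
    have "?U b s = lebesgue b 1 + fps_X ^ b * lebesgue b 2"
      by (simp add: Free)
    also have "\<dots> = transfer run_step ?U b s"
      unfolding 1 2 by (simp add: Free transfer_def mult_2 power_add distrib_left add_ac mult.assoc)
    finally show ?thesis .
  qed (simp_all add: transfer_def 1[simplified] 2)
qed

lemma gf_run_free: "gf run_free = lebesgue 1 1"
proof -
  have "gf run_free = suffix_gf run_step 1 After_Blue_Gap"
    unfolding suffix_gf_def
  proof (rule gf_cong)
    fix R B :: "nat set"
    assume *: "0 \<notin> R" "0 \<notin> B"
    then have "R \<subseteq> {1..}" "B \<subseteq> {1..}"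
      by (auto simp: subset_iff Suc_le_eq intro!: gr0I)
    with accepts_run_step[OF *]
    show "run_free R B \<longleftrightarrow> R \<subseteq> {1..} \<and> B \<subseteq> {1..} \<and> accepts run_step R B After_Blue_Gap 1"
      by blast
  qed
  then show ?thesis
    by (simp add: suffix_gf_run_step)
qed

subsection \<open>From partitions to pairs of sets\<close>

lemma part_pairs_eqpoll:
  assumes "gf P = gf Q"
  shows "part_pairs P n \<approx> part_pairs Q n"
proof -
  have "fps_nth (gf P) n = fps_nth (gf Q) n"
    using assms by simp
  then show ?thesis
    by (simp add: gf_def eqpoll_iff_card finite_part_pairs)
qed

text \<open>Without repeats a bicolored partition is determined by its two color classes.
  \<open>Q\<close> is left arbitrary to serve both bicolored families.\<close>

lemma bicolored_partitions_eqpoll: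
  "{P \<in> bicolored_partitions n. no_repeats P \<and> Q (red_parts P) (blue_parts P)} \<approx> part_pairs Q n"
    (is "?A \<approx> _")
proof -
  define f where "f P = (red_parts P, blue_parts P)" for P
  define g where "g = (\<lambda>(R :: nat set, B :: nat set). mset_set (R \<times> {Red} \<union> B \<times> {Blue}))"
  have parts_g: "red_parts (g (R, B)) = R" "blue_parts (g (R, B)) = B"
    if "finite R" "finite B" for R B
    using that by (auto simp: g_def red_parts_def blue_parts_def)
  have sum_g: "sum_mset (image_mset fst (g (R, B))) = \<Sum>R + \<Sum>B" if "finite R" "finite B" for R B
  proof -
    have "(R \<times> {Red}) \<inter> (B \<times> {Blue}) = {}"
      by auto
    then have "sum fst (R \<times> {Red} \<union> B \<times> {Blue}) = sum fst (R \<times> {Red}) + sum fst (B \<times> {Blue})"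
      using that by (intro sum.union_disjoint) auto
    moreover have "sum fst (S \<times> {c}) = \<Sum>S" for S :: "nat set" and c :: color
      by (rule sum.reindex_bij_witness[of _ "\<lambda>x. (x, c)" fst]) auto
    ultimately show ?thesis
      by (simp add: g_def sum_unfold_sum_mset[symmetric])
  qed
  have fin: "finite (red_parts P)" "finite (blue_parts P)" for P
  proof -
    have "red_parts P \<subseteq> fst ` set_mset P" "blue_parts P \<subseteq> fst ` set_mset P"
      by (force simp: red_parts_def blue_parts_def)+
    then show "finite (red_parts P)" "finite (blue_parts P)"
      by (auto intro: finite_subset)
  qed
  have g_f: "g (f P) = P" if "no_repeats P" for P
  proof -
    have "red_parts P \<times> {Red} \<union> blue_parts P \<times> {Blue} = set_mset P"
      by (auto simp: red_parts_def blue_parts_def) (metis color.exhaust)+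
    then have "g (f P) = mset_set (set_mset P)"
      by (simp add: g_def f_def)
    also have "\<dots> = P"
    proof (rule multiset_eqI)
      fix p
      have "count P p \<le> 1"
        using that unfolding no_repeats_def by blast
      then have "count P p = 1" if "p \<in># P"
        using that by (metis One_nat_def Suc_leI count_greater_zero_iff le_antisym)
      then show "count (mset_set (set_mset P)) p = count P p"
        by (cases "p \<in># P") (simp_all add: not_in_iff)
    qed
    finally show ?thesis .
  qed
  have "bij_betw f ?A (part_pairs Q n)"
  proof (rule bij_betw_byWitness[where f' = g])
    show "\<forall>P\<in>?A. g (f P) = P"
      using g_f by blast
    show "\<forall>p\<in>part_pairs Q n. f (g p) = p"
      by (auto simp: part_pairs_def f_def parts_g)
    show "f ` ?A \<subseteq> part_pairs Q n"
    proof (rule image_subsetI)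
      fix P assume "P \<in> ?A"
      then have P: "P \<in> bicolored_partitions n" "no_repeats P" "Q (red_parts P) (blue_parts P)"
        by auto
      have "\<Sum>(red_parts P) + \<Sum>(blue_parts P) = n"
        using sum_g[OF fin, of P P] g_f[OF P(2)] P(1)
        by (simp add: f_def bicolored_partitions_def)
      then show "f P \<in> part_pairs Q n"
        using P fin by (auto simp: f_def part_pairs_def bicolored_partitions_def
            red_parts_def blue_parts_def)
    qed
    show "g ` part_pairs Q n \<subseteq> ?A"
    proof (rule image_subsetI, unfold split_paired_all)
      fix R B assume "(R, B) \<in> part_pairs Q n"
      then have RB: "finite R" "finite B" "0 \<notin> R" "0 \<notin> B" "Q R B" "\<Sum>R + \<Sum>B = n"
        by (auto simp: part_pairs_def)
      have "p \<in># g (R, B) \<Longrightarrow> fst p > 0" for p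
        using RB by (auto simp: g_def intro!: gr0I)
      then have "g (R, B) \<in> bicolored_partitions n"
        using RB sum_g by (auto simp: bicolored_partitions_def)
      moreover have "no_repeats (g (R, B))"
        by (simp add: no_repeats_def g_def count_mset_set')
      ultimately show "g (R, B) \<in> ?A"
        using RB by (simp add: parts_g)
    qed
  qed
  then show ?thesis
    unfolding eqpoll_def by blast
qed

text \<open>A multiplicity in \<open>{0, 1, 2, 3}\<close> is split into binary digits: the digit of weight 2 at \<open>b\<close>
  becomes a red part \<open>2 * b\<close>.\<close>

lemma partitions_at_most_thrice_eqpoll:
  "partitions_at_most_thrice n \<approx> part_pairs (\<lambda>R B. \<forall>r\<in>R. even r) n" (is "_ \<approx> ?A")
proof -
  define f where "f P = ((*) 2 ` {b. count P b \<ge> 2}, {b. odd (count P b)})" for P :: "nat multiset"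
  define g where "g = (\<lambda>(R :: nat set, B :: nat set).
    mset_set B + repeat_mset 2 (mset_set ((\<lambda>r. r div 2) ` R)))"
  have count_g: "count (g (R, B)) b = of_bool (b \<in> B) + 2 * of_bool (2 * b \<in> R)"
    if "finite R" "finite B" "\<forall>r\<in>R. even r" for R B b
    using that by (auto simp: g_def count_mset_set' image_iff intro: bexI[of _ "2 * b"])
  have sum_g: "sum_mset (g (R, B)) = \<Sum>R + \<Sum>B"
    if "finite R" "finite B" "\<forall>r\<in>R. even r" for R B
  proof -
    have "inj_on (\<lambda>r. r div 2) R"
      using that(3) by (intro inj_onI) (metis dvd_mult_div_cancel)
    then have "2 * \<Sum>((\<lambda>r. r div 2) ` R) = (\<Sum>r\<in>R. 2 * (r div 2))"
      by (simp add: sum.reindex sum_distrib_left)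
    also have "\<dots> = \<Sum>R"
      using that by (intro sum.cong) auto
    finally show ?thesis
      by (simp add: g_def sum_unfold_sum_mset numeral_2_eq_2)
  qed
  have fin: "finite {b. count P b \<ge> 2}" "finite {b. odd (count P b)}" for P :: "nat multiset"
    by (rule finite_subset[OF _ finite_set_mset[of P]];
        force simp: count_eq_zero_iff[symmetric] intro: ccontr)+
  have g_f: "g (f P) = P" if "\<forall>b. count P b \<le> 3" for P
  proof (rule multiset_eqI)
    fix b
    have "count P b = 0 \<or> count P b = 1 \<or> count P b = 2 \<or> count P b = 3"
      using that[rule_format, of b] by linarith
    then show "count (g (f P)) b = count P b"
      unfolding f_def by (subst count_g) (auto simp: fin image_iff)
  qed
  have "bij_betw f (partitions_at_most_thrice n) ?A"
  proof (rule bij_betw_byWitness[where f' = g])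
    show "\<forall>P\<in>partitions_at_most_thrice n. g (f P) = P"
      using g_f by (auto simp: partitions_at_most_thrice_def)
    show "\<forall>p\<in>?A. f (g p) = p"
    proof clarify
      fix R B assume "(R, B) \<in> ?A"
      then have RB: "finite R" "finite B" "\<forall>r\<in>R. even r"
        by (auto simp: part_pairs_def)
      have "(*) 2 ` {b. 2 * b \<in> R} = R"
        using RB by (auto simp: image_iff elim!: evenE)
      then show "f (g (R, B)) = (R, B)"
        by (simp add: f_def count_g[OF RB])
    qed
    show "f ` partitions_at_most_thrice n \<subseteq> ?A"
    proof (rule image_subsetI)
      fix P assume "P \<in> partitions_at_most_thrice n"
      then have P: "count P 0 = 0" "sum_mset P = n" "\<forall>b. count P b \<le> 3"
        by (auto simp: partitions_at_most_thrice_def partitions_def count_eq_zero_iff)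
      have "\<Sum>(fst (f P)) + \<Sum>(snd (f P)) = n"
        using sum_g[of "fst (f P)" "snd (f P)"] g_f[OF P(3)] P(2) fin[of P] by (simp add: f_def)
      then show "f P \<in> ?A"
        using P(1) fin[of P] by (auto simp: part_pairs_def f_def)
    qed
    show "g ` ?A \<subseteq> partitions_at_most_thrice n"
    proof (rule image_subsetI, unfold split_paired_all)
      fix R B assume "(R, B) \<in> ?A"
      then have RB: "finite R" "finite B" "\<forall>r\<in>R. even r" "0 \<notin> R" "0 \<notin> B" "\<Sum>R + \<Sum>B = n"
        by (auto simp: part_pairs_def)
      have "count (g (R, B)) 0 = 0"
        using RB by (simp add: count_g)
      then have "\<forall>b\<in>#g (R, B). b > 0"
        by (metis count_eq_zero_iff gr0I)
      then show "g (R, B) \<in> partitions_at_most_thrice n"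
        using RB by (auto simp: partitions_at_most_thrice_def partitions_def count_g sum_g)
    qed
  qed
  then show ?thesis
    unfolding eqpoll_def by blast
qed

theorem theorem2:
  fixes n :: nat
  shows "partitions_at_most_thrice n \<approx> matched_bicolored_partitions n \<and>
         matched_bicolored_partitions n \<approx> run_free_bicolored_partitions n"
proof
  have matched: "matched_bicolored_partitions n \<approx> part_pairs matchable n"
    using bicolored_partitions_eqpoll[of n matchable]
    by (simp add: matched_bicolored_partitions_def red_matched_def matchable_def)
  \<comment> \<open>Only the place of the condition that \<open>b\<close> is blue differs: inside
    \<open>forbidden_run\<close>, but outside \<open>bad_run\<close>.\<close>
  have "run_free_bicolored_partitions n =
      {P \<in> bicolored_partitions n. no_repeats P \<and> run_free (red_parts P) (blue_parts P)}"
    by (auto simp: run_free_bicolored_partitions_def run_free_def forbidden_run_def bad_run_def)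
  then have free: "run_free_bicolored_partitions n \<approx> part_pairs run_free n"
    using bicolored_partitions_eqpoll[of n run_free] by simp
  show "partitions_at_most_thrice n \<approx> matched_bicolored_partitions n"
    by (intro eqpoll_trans[OF partitions_at_most_thrice_eqpoll]
        eqpoll_trans[OF part_pairs_eqpoll eqpoll_sym[OF matched]])
      (simp add: gf_even_fst gf_matchable)
  show "matched_bicolored_partitions n \<approx> run_free_bicolored_partitions n"
    by (intro eqpoll_trans[OF matched] eqpoll_trans[OF part_pairs_eqpoll eqpoll_sym[OF free]])
      (simp add: gf_run_free gf_matchable)
qed

end
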